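(* There exists a Tychonoff weak $P$-space which is not weakly Volterra.
   Context: A topological space $X$ is a weak $P$-space if every countable subset of $X$ is closed (and hence discrete). A subset is a $G_\delta$ set if it is a countable intersection of open sets. A space $X$ is weakly Volterra if for every pair $G, H$ of dense $G_\delta$ subsets of $X$, the set $G \cap H$ is non-empty. Tychonoff means completely regular and Hausdorff. All spaces are understood to be non-empty. *)

theory Defs
  imports "HOL-Analysis.Analysis"
begin

definition Tychonoff_space :: "'a topology \<Rightarrow> bool" where
  "Tychonoff_space X \<longleftrightarrow> completely_regular_space X \<and> Hausdorff_space X"

definition weak_P_space :: "'a topology \<Rightarrow> bool" where
  "weak_P_space X \<longleftrightarrow> (\<forall>C. C \<subseteq> topspace X \<and> countable C \<longrightarrow> closedin X C)"

definition dense_in :: "'a topology \<Rightarrow> 'a set \<Rightarrow> bool" where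
  "dense_in X S \<longleftrightarrow> S \<subseteq> topspace X \<and> X closure_of S = topspace X"

definition weakly_Volterra_space :: "'a topology \<Rightarrow> bool" where
  "weakly_Volterra_space X \<longleftrightarrow>
     (\<forall>G H. gdelta_in X G \<and> dense_in X G \<and> gdelta_in X H \<and> dense_in X H \<longrightarrow> G \<inter> H \<noteq> {})"

(* The predicates above do not force X to be non-empty, and the empty space satisfies
   Tychonoff_space, weak_P_space and the negation of weakly_Volterra_space; so the standing
   convention that spaces are non-empty has to be stated wherever they are used.

   HOL cannot quantify existentially over types, so an existence claim about spaces has to name
   a type for the points; an example there is in particular an example among all spaces. The type
   real => real serves only as a large supply of points: its own topology plays no role, and
   the underlying set of the space may be any subset of it. *)

end

theory Submission
  imports Defs
begin

text \<open>
  The points are real functions on an uncountable index set that take one constant value, the level,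
  off a countable set of indices. The levels are confined to a countable set \<open>E\<close>. A basic
  neighbourhood of \<open>x\<close> prescribes countably many coordinates exactly, and the level up to a
  positive error.

  Countably many coordinates say nothing about the level, so inside a neighbourhood of \<open>x\<close> every
  level in \<open>E\<close> that is close enough to that of \<open>x\<close> occurs (\<open>dense_levels\<close>). Hence the space
  inherits from \<open>E\<close> its failure of Baire category: if \<open>E\<close> is the union of disjoint countable dense
  sets \<open>A\<close> and \<open>B\<close> of reals, the points with level in \<open>A\<close> and those with level in \<open>B\<close> form
  disjoint dense sets, and each is a \<open>G\<^sub>\<delta>\<close>, as its complement consists of countably many closed
  level sets (\<open>gdelta_levels\<close>).

  All the coordinates together do determine the level, so distinct points differ at some coordinate
  (\<open>cocountably_constant_differ\<close>). Prescribing one such coordinate for each member of a countable set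
  separates a point from that set, which is therefore closed: this gives the weak \<open>P\<close> property.
  Complete regularity comes from the distance of levels, replaced by \<open>1\<close> where a prescribed
  coordinate differs; Hausdorff separation follows because points are closed.

  The indices are the nonzero reals; the value at \<open>0\<close> stores the level, so that the topology can be
  written in terms of values of the functions alone.
\<close>

section \<open>The topology of countable agreement\<close>

text \<open>The index \<open>0\<close> is removed from the prescribed coordinates because it carries the level,
  which is only to be controlled up to \<open>e\<close>.\<close>

definition near :: "real set \<Rightarrow> real \<Rightarrow> (real \<Rightarrow> real) \<Rightarrow> (real \<Rightarrow> real) \<Rightarrow> bool" where
  "near C e x y \<longleftrightarrow> (\<forall>t\<in>C - {0}. y t = x t) \<and> \<bar>y 0 - x 0\<bar> < e"

definition agreement_topology :: "(real \<Rightarrow> real) set \<Rightarrow> (real \<Rightarrow> real) topology" where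
  "agreement_topology S = topology (\<lambda>U. U \<subseteq> S \<and>
     (\<forall>x\<in>U. \<exists>C e. countable C \<and> 0 < e \<and> (\<forall>y\<in>S. near C e x y \<longrightarrow> y \<in> U)))"

lemma near_mono: "near C e x y \<Longrightarrow> C' \<subseteq> C \<Longrightarrow> e \<le> e' \<Longrightarrow> near C' e' x y"
  by (auto simp: near_def)

lemma openin_agreement:
  "openin (agreement_topology S) U \<longleftrightarrow> U \<subseteq> S \<and>
     (\<forall>x\<in>U. \<exists>C e. countable C \<and> 0 < e \<and> (\<forall>y\<in>S. near C e x y \<longrightarrow> y \<in> U))"
proof -
  define P where "P U x \<longleftrightarrow> (\<exists>C e. countable C \<and> 0 < e \<and> (\<forall>y\<in>S. near C e x y \<longrightarrow> y \<in> U))"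
    for U x
  have P_mono: "P V x" if "P U x" "U \<subseteq> V" for U V x
    using that unfolding P_def by blast
  have P_Int: "P (U \<inter> V) x" if U: "P U x" and V: "P V x" for U V x
  proof -
    obtain C c where C: "countable C" "0 < c" "\<forall>y\<in>S. near C c x y \<longrightarrow> y \<in> U"
      using U unfolding P_def by blast
    obtain D d where D: "countable D" "0 < d" "\<forall>y\<in>S. near D d x y \<longrightarrow> y \<in> V"
      using V unfolding P_def by blast
    have "y \<in> U \<inter> V" if "y \<in> S" "near (C \<union> D) (min c d) x y" for y
      using that C D near_mono[OF that(2), of C c] near_mono[OF that(2), of D d] by auto
    then show ?thesis
      unfolding P_def using C(1,2) D(1,2)
      by (intro exI[of _ "C \<union> D"] exI[of _ "min c d"]) auto
  qed
  have "istopology (\<lambda>U. U \<subseteq> S \<and> (\<forall>x\<in>U. P U x))"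
    unfolding istopology_def
  proof (intro conjI allI impI)
    fix U V assume "U \<subseteq> S \<and> (\<forall>x\<in>U. P U x)" "V \<subseteq> S \<and> (\<forall>x\<in>V. P V x)"
    then show "U \<inter> V \<subseteq> S" "\<forall>x\<in>U \<inter> V. P (U \<inter> V) x"
      using P_Int by auto
  next
    fix K assume K: "\<forall>U\<in>K. U \<subseteq> S \<and> (\<forall>x\<in>U. P U x)"
    then show "\<Union>K \<subseteq> S" by blast
    show "\<forall>x\<in>\<Union>K. P (\<Union>K) x"
      using K P_mono by (meson Union_iff Union_upper)
  qed
  then show ?thesis
    unfolding agreement_topology_def P_def by (simp add: topology_inverse')
qed

lemma topspace_agreement [simp]: "topspace (agreement_topology S) = S"
proof
  show "topspace (agreement_topology S) \<subseteq> S"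
    using openin_agreement openin_topspace by blast
  have "openin (agreement_topology S) S"
    unfolding openin_agreement by (auto intro: exI[of _ "{}"] exI[of _ 1])
  then show "S \<subseteq> topspace (agreement_topology S)"
    by (rule openin_subset)
qed

lemma closedin_agreementI:
  assumes "K \<subseteq> S"
    and "\<And>x. x \<in> S \<Longrightarrow> x \<notin> K \<Longrightarrow> \<exists>C e. countable C \<and> 0 < e \<and> (\<forall>y\<in>K. \<not> near C e x y)"
  shows "closedin (agreement_topology S) K"
  unfolding closedin_def openin_agreement topspace_agreement
  using assms by (metis Diff_iff Diff_subset)

lemma closedin_level: "closedin (agreement_topology S) {x \<in> S. x 0 = a}"
proof (rule closedin_agreementI)
  fix x assume "x \<in> S" "x \<notin> {x \<in> S. x 0 = a}"
  then have "0 < \<bar>a - x 0\<bar>" "\<forall>y\<in>{x \<in> S. x 0 = a}. \<not> near {} \<bar>a - x 0\<bar> x y"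
    by (auto simp: near_def)
  then show "\<exists>C e. countable C \<and> 0 < e \<and> (\<forall>y\<in>{x \<in> S. x 0 = a}. \<not> near C e x y)"
    by (intro exI[of _ "{}"] exI[of _ "\<bar>a - x 0\<bar>"]) simp
qed auto

lemma continuous_map_agreementI:
  fixes f :: "(real \<Rightarrow> real) \<Rightarrow> real"
  assumes "countable C" "0 < k"
    and lip: "\<And>x y e. x \<in> S \<Longrightarrow> y \<in> S \<Longrightarrow> near C e x y \<Longrightarrow> \<bar>f y - f x\<bar> \<le> e / k"
  shows "continuous_map (agreement_topology S) euclideanreal f"
  unfolding continuous_map_def
proof (intro conjI allI impI)
  fix V :: "real set" assume "openin euclidean V"
  then have V: "open V" by simp
  have "\<exists>D d. countable D \<and> 0 < d \<and>
          (\<forall>y\<in>S. near D d x y \<longrightarrow> y \<in> {x \<in> topspace (agreement_topology S). f x \<in> V})"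
    if x: "x \<in> S" "f x \<in> V" for x
  proof -
    obtain e where e: "0 < e" "\<And>r. \<bar>r - f x\<bar> < e \<Longrightarrow> r \<in> V"
      using V x(2) unfolding open_dist dist_real_def by blast
    have "f y \<in> V" if "y \<in> S" "near C (k * e / 2) x y" for y
      using lip[OF x(1) that] e assms(2) by auto
    then show ?thesis
      using assms(1,2) e(1) by (intro exI[of _ C] exI[of _ "k * e / 2"]) auto
  qed
  then show "openin (agreement_topology S) {x \<in> topspace (agreement_topology S). f x \<in> V}"
    unfolding openin_agreement by auto
qed simp

text \<open>Two points that agree on \<open>C\<close> fall under the same case of the separating function below, so
  its oscillation between them is at most that of the level, divided by the radius \<open>e\<close>.\<close>

lemma completely_regular_agreement: "completely_regular_space (agreement_topology S)"
  unfolding completely_regular_space_alt'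
proof (intro allI impI)
  fix U x assume "openin (agreement_topology S) U" "x \<in> U"
  then obtain C e where C: "countable C" "0 < e" "\<And>y. y \<in> S \<Longrightarrow> near C e x y \<Longrightarrow> y \<in> U"
    unfolding openin_agreement by meson
  define f where
    "f y = (if \<forall>t\<in>C - {0}. y t = x t then min 1 (\<bar>y 0 - x 0\<bar> / e) else 1)" for y :: "real \<Rightarrow> real"
  have min_lip: "\<bar>min 1 a - min 1 b\<bar> \<le> \<bar>a - b\<bar>" for a b :: real
    by linarith
  have "\<bar>f z - f y\<bar> \<le> d / e" if d: "near C d y z" for y z d
  proof (cases "\<forall>t\<in>C - {0}. y t = x t")
    case True
    then have "f z = min 1 (\<bar>z 0 - x 0\<bar> / e)" "f y = min 1 (\<bar>y 0 - x 0\<bar> / e)"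
      using d by (auto simp: near_def f_def)
    then have "\<bar>f z - f y\<bar> \<le> \<bar>\<bar>z 0 - x 0\<bar> / e - \<bar>y 0 - x 0\<bar> / e\<bar>"
      using min_lip by metis
    also have "\<dots> = \<bar>\<bar>z 0 - x 0\<bar> - \<bar>y 0 - x 0\<bar>\<bar> / e"
      using C(2) by (simp flip: diff_divide_distrib)
    also have "\<dots> \<le> d / e"
      using d C(2) by (intro divide_right_mono) (auto simp: near_def)
    finally show ?thesis .
  next
    case False
    then have "f z = 1" "f y = 1"
      using d by (auto simp: near_def f_def)
    then show ?thesis
      using d C(2) by (auto simp: near_def)
  qed
  then have "continuous_map (agreement_topology S) euclideanreal f"
    using C(1,2) by (intro continuous_map_agreementI)
  moreover have "f x = 0"
    by (simp add: f_def)
  moreover have "f y = 1" if "y \<in> S - U" for y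
  proof -
    have "\<not> near C e x y"
      using that C(3) by blast
    then show ?thesis
      using C(2) by (auto simp: f_def near_def min_def field_simps)
  qed
  ultimately show "\<exists>f. continuous_map (agreement_topology S) euclideanreal f \<and> f x = 0 \<and>
      f ` (topspace (agreement_topology S) - U) \<subseteq> {1}"
    by auto
qed

lemma Tychonoff_if_weak_P:
  assumes "completely_regular_space X" "weak_P_space X"
  shows "Tychonoff_space X"
proof -
  have "t1_space X"
    using assms(2) by (simp add: t1_space_closedin_singleton weak_P_space_def)
  then show ?thesis
    using assms(1) by (simp add: Tychonoff_space_def completely_regular_imp_regular_space
        regular_t1_imp_Hausdorff_space)
qed

section \<open>Functions that are constant off a countable set\<close>

definition cocountably_constant :: "real set \<Rightarrow> (real \<Rightarrow> real) set" where
  "cocountably_constant E = {x. x 0 \<in> E \<and> countable {t. x t \<noteq> x 0}}"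

text \<open>Two countable sets of exceptional indices leave a common index at which both functions
  take their levels; so the other coordinates determine the level.\<close>

lemma cocountably_constant_differ:
  assumes "x \<in> cocountably_constant E" "y \<in> cocountably_constant E" "x \<noteq> y"
  obtains t where "t \<noteq> 0" "x t \<noteq> y t"
proof -
  have "\<exists>t. t \<noteq> 0 \<and> x t \<noteq> y t"
  proof (rule ccontr)
    assume "\<nexists>t. t \<noteq> 0 \<and> x t \<noteq> y t"
    then have eq: "x t = y t" if "t \<noteq> 0" for t
      using that by blast
    have "countable ({t. x t \<noteq> x 0} \<union> {t. y t \<noteq> y 0} \<union> {0})"
      using assms(1,2) by (auto simp: cocountably_constant_def)
    then have "{t. x t \<noteq> x 0} \<union> {t. y t \<noteq> y 0} \<union> {0} \<noteq> UNIV"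
      using uncountable_UNIV_real by (metis (no_types))
    then obtain t where "t \<noteq> 0" "x t = x 0" "y t = y 0"
      by auto
    then have "x 0 = y 0"
      using eq[of t] by simp
    then have "x t = y t" for t
      using eq by (cases "t = 0") auto
    then have "x = y"
      by (rule ext)
    then show False
      using assms(3) by simp
  qed
  then show thesis
    using that by blast
qed

lemma weak_P_cocountably_constant:
  "weak_P_space (agreement_topology (cocountably_constant E))"
  unfolding weak_P_space_def topspace_agreement
proof (intro allI impI, elim conjE)
  let ?S = "cocountably_constant E"
  fix K assume K: "K \<subseteq> ?S" "countable K"
  show "closedin (agreement_topology ?S) K"
  proof (rule closedin_agreementI)
    fix x assume x: "x \<in> ?S" "x \<notin> K"
    have "\<exists>t. t \<noteq> 0 \<and> x t \<noteq> y t" if "y \<in> K" for y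
      using cocountably_constant_differ[of x E y] x K(1) that by blast
    then obtain s where s: "\<And>y. y \<in> K \<Longrightarrow> s y \<noteq> 0 \<and> x (s y) \<noteq> y (s y)"
      by metis
    have "\<forall>y\<in>K. \<not> near (s ` K) 1 x y"
      using s by (force simp: near_def)
    then show "\<exists>C e. countable C \<and> 0 < e \<and> (\<forall>y\<in>K. \<not> near C e x y)"
      using K(2) by (intro exI[of _ "s ` K"] exI[of _ 1]) auto
  qed fact
qed

text \<open>Inside a neighbourhood of \<open>x\<close> prescribing the coordinates in \<open>C\<close>, the level is changed to any
  nearby \<open>a\<close> by keeping \<open>x\<close> on \<open>C\<close> and putting \<open>a\<close> elsewhere.\<close>

lemma dense_levels:
  assumes "A \<subseteq> E"
    and dense: "\<And>u v. u < v \<Longrightarrow> \<exists>a\<in>A. u < a \<and> a < v"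
  shows "dense_in (agreement_topology (cocountably_constant E)) {x \<in> cocountably_constant E. x 0 \<in> A}"
    (is "dense_in (agreement_topology ?S) ?G")
proof -
  have "?G \<inter> U \<noteq> {}" if U: "openin (agreement_topology ?S) U" and "U \<noteq> {}" for U
  proof -
    obtain x where x: "x \<in> U"
      using \<open>U \<noteq> {}\<close> by blast
    obtain C e where C: "countable C" "0 < e" "\<And>y. y \<in> ?S \<Longrightarrow> near C e x y \<Longrightarrow> y \<in> U"
      using U x unfolding openin_agreement by meson
    obtain a where a: "a \<in> A" "x 0 - e < a" "a < x 0 + e"
      using dense[of "x 0 - e" "x 0 + e"] C(2) by auto
    define y where "y t = (if t \<in> C - {0} then x t else a)" for t
    have "{t. y t \<noteq> y 0} \<subseteq> C"
      by (auto simp: y_def)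
    then have "countable {t. y t \<noteq> y 0}"
      using C(1) countable_subset by blast
    then have "y \<in> ?S" "y 0 \<in> A"
      using a(1) assms(1) by (auto simp: cocountably_constant_def y_def)
    moreover have "near C e x y"
      using a by (auto simp: near_def y_def)
    ultimately show ?thesis
      using C(3) by blast
  qed
  then show ?thesis
    unfolding dense_in_def dense_intersects_open by auto
qed

lemma gdelta_levels:
  assumes "countable B" "A \<inter> B = {}"
  shows "gdelta_in (agreement_topology (cocountably_constant (A \<union> B)))
           {x \<in> cocountably_constant (A \<union> B). x 0 \<in> A}"
    (is "gdelta_in ?X {x \<in> ?S. _}")
proof -
  have "fsigma_in ?X (\<Union>b\<in>B. {x \<in> ?S. x 0 = b})"
    using assms(1) by (intro fsigma_in_Union) (auto intro: closed_imp_fsigma_in closedin_level)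
  also have "(\<Union>b\<in>B. {x \<in> ?S. x 0 = b}) = topspace ?X - {x \<in> ?S. x 0 \<in> A}"
    using assms(2) by (auto simp: cocountably_constant_def)
  finally show ?thesis
    unfolding gdelta_in_fsigma_in by auto
qed

lemma not_weakly_Volterra_cocountably_constant:
  assumes "countable A" "countable B" "A \<inter> B = {}"
    and "\<And>u v. u < v \<Longrightarrow> \<exists>a\<in>A. u < a \<and> a < v"
    and "\<And>u v. u < v \<Longrightarrow> \<exists>b\<in>B. u < b \<and> b < v"
  shows "\<not> weakly_Volterra_space (agreement_topology (cocountably_constant (A \<union> B)))"
proof -
  let ?S = "cocountably_constant (A \<union> B)"
  have "gdelta_in (agreement_topology ?S) {x \<in> ?S. x 0 \<in> A}"
    using gdelta_levels assms by blast
  moreover have "gdelta_in (agreement_topology ?S) {x \<in> ?S. x 0 \<in> B}"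
    using gdelta_levels[of A B] assms by (simp add: Un_commute Int_commute)
  moreover have "dense_in (agreement_topology ?S) {x \<in> ?S. x 0 \<in> A}"
    "dense_in (agreement_topology ?S) {x \<in> ?S. x 0 \<in> B}"
    using assms by (auto intro!: dense_levels)
  moreover have "{x \<in> ?S. x 0 \<in> A} \<inter> {x \<in> ?S. x 0 \<in> B} = {}"
    using assms(3) by blast
  ultimately show ?thesis
    unfolding weakly_Volterra_space_def by blast
qed

text \<open>Both sets of levels can be had from the rationals, by a translation by an irrational number.\<close>

lemma disjoint_countable_dense_sets:
  obtains A B :: "real set" where "countable A" "countable B" "A \<inter> B = {}"
    "\<And>u v. u < v \<Longrightarrow> \<exists>a\<in>A. u < a \<and> a < v"
    "\<And>u v. u < v \<Longrightarrow> \<exists>b\<in>B. u < b \<and> b < v"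
proof -
  obtain r :: real where r: "r \<notin> \<rat>"
    using uncountable_UNIV_real countable_rat countable_subset[of UNIV "\<rat>"] by blast
  have "\<exists>b\<in>(+) r ` \<rat>. u < b \<and> b < v" if "u < v" for u v
    using Rats_dense_in_real[of "u - r" "v - r"] that by (force simp: algebra_simps)
  moreover have "\<rat> \<inter> (+) r ` \<rat> = {}"
    using r Rats_diff by fastforce
  ultimately show thesis
    using that[of \<rat> "(+) r ` \<rat>"] Rats_dense_in_real countable_rat by blast
qed

theorem mainTheorem3:
  shows "\<exists>X :: (real \<Rightarrow> real) topology.
           topspace X \<noteq> {} \<and> Tychonoff_space X \<and> weak_P_space X \<and> \<not> weakly_Volterra_space X"
proof -
  obtain A B :: "real set" where AB: "countable A" "countable B" "A \<inter> B = {}"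
    "\<And>u v. u < v \<Longrightarrow> \<exists>a\<in>A. u < a \<and> a < v"
    "\<And>u v. u < v \<Longrightarrow> \<exists>b\<in>B. u < b \<and> b < v"
    by (rule disjoint_countable_dense_sets) blast
  let ?S = "cocountably_constant (A \<union> B)"
  obtain a where "a \<in> A"
    using AB(4)[of 0 1] by auto
  then have "(\<lambda>t. a) \<in> ?S"
    by (simp add: cocountably_constant_def)
  then have "topspace (agreement_topology ?S) \<noteq> {}"
    by auto
  moreover have "\<not> weakly_Volterra_space (agreement_topology ?S)"
    using AB by (rule not_weakly_Volterra_cocountably_constant)
  ultimately show ?thesis
    using weak_P_cocountably_constant completely_regular_agreement Tychonoff_if_weak_P by blast
qed

end
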